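(* Let $n \geq 2$ and let $p(z)=\sum_{j=0}^{n} a_j z^j$ be a real polynomial with positive coefficients $a_0,\dots,a_n>0$. Let $$\mu_1=\left(\max_{0\leq j\leq n-2}\frac{a_j}{a_{j+2}}\right)^{1/2}\quad\text{and}\quad \mu_2=\left(\min_{0\leq j\leq n-2}\frac{a_j}{a_{j+2}}\right)^{1/2}.$$ Then all the zeros of $p$ are included in the closed disk $$D_1=\left\{z\in\mathbb{C}:\left|z+\frac{a_{n-1}}{a_n}\right|\leq \frac{a_{n-1}}{a_n}+\mu_1\right\},$$ but are excluded from the open disk $$D_2=\left\{z\in\mathbb{C}:\left|z-\frac{\mu_2^2}{a_0/a_1+2\mu_2}\right|<\frac{\mu_2\,(a_0/a_1+\mu_2)}{a_0/a_1+2\mu_2}\right\}.$$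
   Context: Zeros are complex zeros. *)

theory Defs
  imports Complex_Main "HOL-Computational_Algebra.Polynomial"
begin

end

theory Submission imports Defs
begin

text \<open>
  Inclusion in a disk is obtained by multiplying \<open>p\<close> with \<open>z\<^sup>2 - m\<^sup>2\<close>, where
  \<open>a\<^sub>j \<le> m\<^sup>2 a\<^sub>j\<^sub>+\<^sub>2\<close> for all \<open>j\<close>. Of the coefficients of the product only the two leading
  ones, \<open>a\<^sub>n\<close> and \<open>a\<^sub>n\<^sub>-\<^sub>1\<close>, are positive; all others are \<open>\<le> 0\<close>. Hence at a zero \<open>z\<close> of \<open>p\<close> with
  \<open>\<bar>z\<bar> = r\<close>, moving the non-positive part to the other side and using the triangle inequality gives
  \<open>\<bar>a\<^sub>n z + a\<^sub>n\<^sub>-\<^sub>1\<bar> r\<^sup>n\<^sup>+\<^sup>1 \<le> (a\<^sub>n r + a\<^sub>n\<^sub>-\<^sub>1) r\<^sup>n\<^sup>+\<^sup>1 - (r\<^sup>2 - m\<^sup>2) p(r)\<close>.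
  If \<open>r > m\<close>, then \<open>p(r)\<close> may be bounded below by its two leading terms, and with
  \<open>b = a\<^sub>n\<^sub>-\<^sub>1 / a\<^sub>n\<close> there remains \<open>\<bar>z + b\<bar> \<le> m\<^sup>2 (r + b) / r\<^sup>2 \<le> b + m\<close>; if \<open>r \<le> m\<close> this bound is
  trivial. This is lemma \<open>zeros_in_disk_of_ratio_bound\<close>.

  Exclusion from the second disk is the same result for the reversed polynomial
  \<open>z\<^sup>n p(1/z)\<close>, whose ratios are the reciprocals of those of \<open>p\<close>: the reciprocals of the zeros
  lie in a disk with \<open>0\<close> in its interior. Inversion maps the exterior of that disk onto the
  open disk \<open>D\<^sub>2\<close> without its point \<open>0\<close>, which is not a zero of \<open>p\<close>; so the zeros avoid
  \<open>D\<^sub>2\<close> (lemma \<open>outside_disk_of_inverse_in_disk\<close>).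
\<close>

text \<open>
  The product is arranged with the two leading terms kept apart from the ones whose sign
  is known. It is used both at the complex zero and at its absolute value.
\<close>

lemma square_minus_times_polynomial:
  fixes a :: "nat \<Rightarrow> 'a::comm_ring_1"
  shows "(x\<^sup>2 - t) * (\<Sum>j\<le>k+2. a j * x ^ j) =
    (a (k+2) * x + a (k+1)) * x ^ (k+3)
      - (t * a 0 + t * a 1 * x + (\<Sum>j\<le>k. (t * a (j+2) - a j) * x ^ (j+2)))"
proof -
  have top: "(\<Sum>j\<le>k+2. a j * x ^ j)
      = (\<Sum>j\<le>k. a j * x ^ j) + a (k+1) * x ^ (k+1) + a (k+2) * x ^ (k+2)"
    by simp
  have bot: "(\<Sum>j\<le>k+2. a j * x ^ j) = a 0 + a 1 * x + (\<Sum>j\<le>k. a (j+2) * x ^ (j+2))"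
    by (simp add: sum.atMost_Suc_shift add.assoc del: sum.atMost_Suc power_Suc)
  have shift: "x\<^sup>2 * (\<Sum>j\<le>k. a j * x ^ j) = (\<Sum>j\<le>k. a j * x ^ (j+2))"
    by (simp add: sum_distrib_left power2_eq_square algebra_simps)
  have "x\<^sup>2 * (\<Sum>j\<le>k+2. a j * x ^ j)
      = (\<Sum>j\<le>k. a j * x ^ (j+2)) + (a (k+2) * x + a (k+1)) * x ^ (k+3)"
    unfolding top shift[symmetric] by (simp add: power2_eq_square eval_nat_numeral algebra_simps)
  moreover have "t * (\<Sum>j\<le>k+2. a j * x ^ j)
      = t * a 0 + t * a 1 * x + (\<Sum>j\<le>k. t * a (j+2) * x ^ (j+2))"
    unfolding bot by (simp add: sum_distrib_left algebra_simps)
  ultimately show ?thesis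
    by (simp add: left_diff_distrib sum_subtractf)
qed

lemma zeros_in_disk_of_ratio_bound:
  fixes a :: "nat \<Rightarrow> real" and z :: complex
  assumes pos: "\<And>j. j \<le> k+2 \<Longrightarrow> a j > 0"
    and m: "m > 0"
    and ratio: "\<And>j. j \<le> k \<Longrightarrow> a j \<le> m\<^sup>2 * a (j+2)"
    and zero: "(\<Sum>j\<le>k+2. of_real (a j) * z ^ j) = 0"
  shows "cmod (z + of_real (a (k+1) / a (k+2))) \<le> a (k+1) / a (k+2) + m"
proof -
  define r where "r = cmod z"
  define b where "b = a (k+1) / a (k+2)"
  have A: "a (k+2) > 0" and b: "b > 0"
    using pos[of "k+1"] pos[of "k+2"] by (auto simp: b_def)
  have ab: "a (k+1) = a (k+2) * b"
    using A by (simp add: b_def)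
  show ?thesis
  proof (cases "r \<le> m")
    case True
    have "cmod (z + of_real b) \<le> r + b"
      using norm_triangle_ineq[of z "of_real b"] b by (simp add: r_def)
    then show ?thesis
      using True by (simp add: b_def)
  next
    case False
    then have r: "r > m" by simp
    with m have r0: "r > 0" by simp
    have "(of_real (a (k+2)) * z + of_real (a (k+1))) * z ^ (k+3) =
      of_real (m\<^sup>2 * a 0) + of_real (m\<^sup>2 * a 1) * z
        + (\<Sum>j\<le>k. of_real (m\<^sup>2 * a (j+2) - a j) * z ^ (j+2))"
      (is "?L = ?R")
      using square_minus_times_polynomial[of z "of_real (m\<^sup>2)" "\<lambda>j. of_real (a j)" k] zero
      by simp
    then have "cmod ?L = cmod ?R" by simp
    also have "\<dots> \<le> m\<^sup>2 * a 0 + m\<^sup>2 * a 1 * r + (\<Sum>j\<le>k. (m\<^sup>2 * a (j+2) - a j) * r ^ (j+2))"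
    proof (intro order.trans[OF norm_triangle_ineq] add_mono sum_norm_le)
      show "cmod (of_real (m\<^sup>2 * a 0)) \<le> m\<^sup>2 * a 0"
        using pos[of 0] by (simp del: of_real_mult of_real_power)
      show "cmod (of_real (m\<^sup>2 * a 1) * z) \<le> m\<^sup>2 * a 1 * r"
        using pos[of 1] by (simp add: norm_mult norm_power r_def)
      show "cmod (of_real (m\<^sup>2 * a (j+2) - a j) * z ^ (j+2)) \<le> (m\<^sup>2 * a (j+2) - a j) * r ^ (j+2)"
        if "j \<in> {..k}" for j
        using ratio[of j] that
        by (simp add: norm_mult norm_power r_def del: of_real_diff of_real_mult)
    qed
    also have "\<dots> = (a (k+2) * r + a (k+1)) * r ^ (k+3) - (r\<^sup>2 - m\<^sup>2) * (\<Sum>j\<le>k+2. a j * r ^ j)"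
      using square_minus_times_polynomial[of r "m\<^sup>2" a k] by simp
    also have "\<dots> \<le> (a (k+2) * r + a (k+1)) * r ^ (k+3)
        - (r\<^sup>2 - m\<^sup>2) * ((a (k+2) * r + a (k+1)) * r ^ (k+1))"
    proof -
      have "(\<Sum>j\<le>k. a j * r ^ j) \<ge> 0"
        using pos r0 by (intro sum_nonneg mult_nonneg_nonneg) (auto intro: less_imp_le)
      then have "(a (k+2) * r + a (k+1)) * r ^ (k+1) \<le> (\<Sum>j\<le>k+2. a j * r ^ j)"
        by (simp add: algebra_simps)
      moreover have "m\<^sup>2 \<le> r\<^sup>2"
        using r m by (simp add: power_mono)
      ultimately show ?thesis
        by (intro diff_left_mono mult_left_mono) auto
    qed
    also have "\<dots> = m\<^sup>2 * (a (k+2) * (r + b)) * r ^ (k+1)"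
      unfolding ab by (simp add: power2_eq_square eval_nat_numeral algebra_simps)
    finally have bound: "cmod ?L \<le> m\<^sup>2 * (a (k+2) * (r + b)) * r ^ (k+1)" .
    have "?L = of_real (a (k+2)) * (z + of_real b) * z ^ (k+3)"
      unfolding ab by (simp add: algebra_simps)
    then have "cmod ?L = cmod (of_real (a (k+2)) * (z + of_real b) * z ^ (k+3))"
      by (rule arg_cong)
    also have "\<dots> = a (k+2) * cmod (z + of_real b) * r ^ (k+3)"
      using A by (simp add: norm_mult norm_power r_def)
    also have "\<dots> = (a (k+2) * r ^ (k+1)) * (cmod (z + of_real b) * r\<^sup>2)"
      by (simp add: power2_eq_square eval_nat_numeral)
    finally have "(a (k+2) * r ^ (k+1)) * (cmod (z + of_real b) * r\<^sup>2)
        \<le> (a (k+2) * r ^ (k+1)) * (m\<^sup>2 * (r + b))"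
      using bound by (simp add: mult_ac)
    then have "cmod (z + of_real b) * r\<^sup>2 \<le> m\<^sup>2 * (r + b)"
      using A r0 by (simp add: mult_le_cancel_left_pos del: power_Suc)
    also have "\<dots> = m * (m * r) + m\<^sup>2 * b"
      by (simp add: power2_eq_square algebra_simps)
    also have "\<dots> \<le> m * r\<^sup>2 + r\<^sup>2 * b"
    proof (intro add_mono mult_left_mono mult_right_mono)
      show "m * r \<le> r\<^sup>2"
        using r r0 by (simp add: power2_eq_square)
      show "m\<^sup>2 \<le> r\<^sup>2"
        using r m by (simp add: power_mono)
    qed (use m b in auto)
    also have "\<dots> = (b + m) * r\<^sup>2"
      by (simp add: algebra_simps)
    finally show ?thesis
      using r0 by (simp add: b_def)
  qed
qed

text \<open>
  Clearing denominators and squaring, both disk conditions become comparisons of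
  \<open>(d + 2m) \<bar>z\<bar>\<^sup>2\<close> with \<open>m\<^sup>2 (d + 2 Re z)\<close>, in opposite directions.
\<close>

lemma outside_disk_of_inverse_in_disk:
  fixes z :: complex and d m :: real
  assumes d: "d > 0" and m: "m > 0" and z: "z \<noteq> 0"
    and inv: "cmod (inverse z + of_real (1 / d)) \<le> 1 / d + 1 / m"
  shows "\<not> cmod (z - of_real (m\<^sup>2 / (d + 2 * m))) < m * (d + m) / (d + 2 * m)"
proof
  assume inside: "cmod (z - of_real (m\<^sup>2 / (d + 2 * m))) < m * (d + m) / (d + 2 * m)"
  define E where "E = d + 2 * m"
  have E: "E > 0" using d m by (simp add: E_def)
  define x y where "x = Re z" and "y = Im z"
  have norm2: "(cmod w)\<^sup>2 = (Re w)\<^sup>2 + (Im w)\<^sup>2" for w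
    by (simp add: cmod_power2)
  have "of_real d + z = of_real d * z * (inverse z + of_real (1 / d))"
    using z d by (simp add: field_simps)
  then have "m * cmod (of_real d + z) = m * (d * cmod z * cmod (inverse z + of_real (1 / d)))"
    using d by (simp add: norm_mult)
  also have "\<dots> \<le> m * (d * cmod z * (1 / d + 1 / m))"
    using inv d m by (intro mult_left_mono) auto
  also have "\<dots> = (d + m) * cmod z"
    using d m by (simp add: field_simps)
  finally have "(m * cmod (of_real d + z))\<^sup>2 \<le> ((d + m) * cmod z)\<^sup>2"
    using m by (intro power_mono) auto
  then have "m\<^sup>2 * ((d + x)\<^sup>2 + y\<^sup>2) \<le> (d + m)\<^sup>2 * (x\<^sup>2 + y\<^sup>2)"
    by (simp add: power_mult_distrib norm2 x_def y_def)
  then have "d * (m\<^sup>2 * (d + 2 * x)) \<le> d * (E * (x\<^sup>2 + y\<^sup>2))"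
    by (simp add: E_def power2_eq_square algebra_simps)
  then have lower: "m\<^sup>2 * (d + 2 * x) \<le> E * (x\<^sup>2 + y\<^sup>2)"
    using d by simp
  have "E * cmod (z - of_real (m\<^sup>2 / E)) < m * (d + m)"
    using inside E unfolding E_def[symmetric] by (simp only: pos_less_divide_eq mult.commute)
  moreover have "E * cmod (z - of_real (m\<^sup>2 / E)) = cmod (of_real E * z - of_real (m\<^sup>2))"
  proof -
    have "of_real E * z - of_real (m\<^sup>2) = of_real E * (z - of_real (m\<^sup>2 / E))"
      using E by (simp add: field_simps)
    then show ?thesis
      using E by (simp add: norm_mult)
  qed
  ultimately have "(cmod (of_real E * z - of_real (m\<^sup>2)))\<^sup>2 < (m * (d + m))\<^sup>2"
    by (intro power_strict_mono) auto
  then have "(E * x - m\<^sup>2)\<^sup>2 + (E * y)\<^sup>2 < (m * (d + m))\<^sup>2"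
    by (simp add: norm2 x_def y_def del: of_real_power)
  then have "E * (E * (x\<^sup>2 + y\<^sup>2)) < E * (m\<^sup>2 * (d + 2 * x))"
    by (simp add: E_def power2_eq_square algebra_simps)
  then show False
    using lower E by simp
qed

lemma reversed_polynomial_at_inverse:
  fixes a :: "nat \<Rightarrow> 'a::field"
  assumes "z \<noteq> 0"
  shows "z ^ n * (\<Sum>j\<le>n. a (n - j) * inverse z ^ j) = (\<Sum>j\<le>n. a j * z ^ j)"
proof -
  have "z ^ n * (\<Sum>j\<le>n. a (n - j) * inverse z ^ j) = (\<Sum>j\<le>n. a (n - j) * z ^ (n - j))"
    using assms
    by (auto simp: sum_distrib_left power_diff power_inverse field_simps intro!: sum.cong)
  also have "\<dots> = (\<Sum>j\<le>n. a j * z ^ j)"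
    by (rule sum.nat_diff_reindex[of "\<lambda>j. a j * z ^ j" "Suc n", unfolded lessThan_Suc_atMost, simplified])
  finally show ?thesis .
qed

theorem theorem4p1:
  fixes n :: nat and a :: "nat \<Rightarrow> real" and p :: "real poly" and \<mu>\<^sub>1 \<mu>\<^sub>2 :: real
    and D\<^sub>1 D\<^sub>2 :: "complex set"
  assumes n: "n \<ge> 2"
    and p: "p = (\<Sum>j=0..n. monom (a j) j)"
    and pos: "\<And>j. j \<le> n \<Longrightarrow> a j > 0"
    and mu1: "\<mu>\<^sub>1 = sqrt (MAX j\<in>{0..n-2}. a j / a (j + 2))"
    and mu2: "\<mu>\<^sub>2 = sqrt (MIN j\<in>{0..n-2}. a j / a (j + 2))"
    and D1: "D\<^sub>1 = {z. cmod (z + complex_of_real (a (n - 1) / a n)) \<le> a (n - 1) / a n + \<mu>\<^sub>1}"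
    and D2: "D\<^sub>2 = {z. cmod (z - complex_of_real (\<mu>\<^sub>2\<^sup>2 / (a 0 / a 1 + 2 * \<mu>\<^sub>2)))
                      < \<mu>\<^sub>2 * (a 0 / a 1 + \<mu>\<^sub>2) / (a 0 / a 1 + 2 * \<mu>\<^sub>2)}"
  shows "{z :: complex. poly (map_poly complex_of_real p) z = 0} \<subseteq> D\<^sub>1
       \<and> {z :: complex. poly (map_poly complex_of_real p) z = 0} \<inter> D\<^sub>2 = {}"
proof -
  define k where "k = n - 2"
  have nk: "n = k + 2" using n by (simp add: k_def)
  have posk: "a j > 0" if "j \<le> k + 2" for j
    using pos that nk by simp
  define S where "S = (\<lambda>j. a j / a (j + 2)) ` {0..k}"
  have S: "finite S" "S \<noteq> {}" "\<And>s. s \<in> S \<Longrightarrow> s > 0"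
    using posk by (auto simp: S_def)
  have mu: "\<mu>\<^sub>1 = sqrt (Max S)" "\<mu>\<^sub>2 = sqrt (Min S)"
    using mu1 mu2 by (simp_all add: S_def k_def)
  have Max_pos: "Max S > 0" and Min_pos: "Min S > 0"
    using S Max_in[OF S(1,2)] Min_in[OF S(1,2)] by auto
  have mu_pos: "\<mu>\<^sub>1 > 0" "\<mu>\<^sub>2 > 0" and mu_sq: "\<mu>\<^sub>1\<^sup>2 = Max S" "\<mu>\<^sub>2\<^sup>2 = Min S"
    using Max_pos Min_pos by (auto simp: mu)
  have upper: "a j \<le> \<mu>\<^sub>1\<^sup>2 * a (j+2)" and lower: "\<mu>\<^sub>2\<^sup>2 * a (j+2) \<le> a j" if "j \<le> k" for j
  proof -
    have "a j / a (j+2) \<in> S" using that by (auto simp: S_def)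
    then have "a j / a (j+2) \<le> Max S" "Min S \<le> a j / a (j+2)"
      using S by auto
    then show "a j \<le> \<mu>\<^sub>1\<^sup>2 * a (j+2)" "\<mu>\<^sub>2\<^sup>2 * a (j+2) \<le> a j"
      using posk[of "j+2"] that by (auto simp: mu_sq field_simps)
  qed
  have eval: "poly (map_poly complex_of_real p) z = (\<Sum>j\<le>k+2. of_real (a j) * z ^ j)" for z
  proof -
    have "map_poly complex_of_real p = (\<Sum>j\<le>k+2. monom (of_real (a j)) j)"
      by (rule poly_eqI)
        (auto simp: p nk coeff_map_poly coeff_sum atLeast0AtMost intro!: sum.cong)
    then show ?thesis
      by (simp only: poly_sum poly_monom)
  qed
  have "z \<in> D\<^sub>1 \<and> z \<notin> D\<^sub>2" if "poly (map_poly complex_of_real p) z = 0" for z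
  proof
    have zero: "(\<Sum>j\<le>k+2. of_real (a j) * z ^ j) = 0"
      using that eval by simp
    show "z \<in> D\<^sub>1"
      using zeros_in_disk_of_ratio_bound[where a = a, OF posk mu_pos(1) upper zero]
      by (simp add: D1 nk)
    have z: "z \<noteq> 0"
    proof
      assume "z = 0"
      with zero have "a 0 = 0"
        by (simp add: sum.atMost_Suc_shift del: sum.atMost_Suc)
      then show False using posk[of 0] by simp
    qed
    define w where "w = inverse z"
    have zero': "(\<Sum>j\<le>k+2. of_real (a (k+2-j)) * w ^ j) = 0"
      using reversed_polynomial_at_inverse[OF z, of "k+2" "\<lambda>j. complex_of_real (a j)"] zero z
      by (simp only: w_def) simp
    have "cmod (w + of_real (a (k+2-(k+1)) / a (k+2-(k+2))))
        \<le> a (k+2-(k+1)) / a (k+2-(k+2)) + 1 / \<mu>\<^sub>2"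
    proof (rule zeros_in_disk_of_ratio_bound[where a = "\<lambda>j. a (k+2-j)"])
      show "a (k+2-j) \<le> (1 / \<mu>\<^sub>2)\<^sup>2 * a (k+2-(j+2))" if "j \<le> k" for j
        using lower[of "k-j"] that mu_pos(2)
        by (simp add: power_divide field_simps Suc_diff_le)
    qed (use posk mu_pos zero' in auto)
    then have "cmod (inverse z + of_real (1 / (a 0 / a 1))) \<le> 1 / (a 0 / a 1) + 1 / \<mu>\<^sub>2"
      by (simp add: w_def)
    from outside_disk_of_inverse_in_disk[OF _ mu_pos(2) z this]
    show "z \<notin> D\<^sub>2"
      using posk[of 0] posk[of 1] by (simp add: D2)
  qed
  then show ?thesis by auto
qed

end
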